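(* Let $\mathbb{F}$ be a field and let $A$ be a strictly upper-triangular matrix of $\mathcal{M}_{Cf}(\mathbb{F})$. Then $I_{\mathbb{N}}+A$ is the product of two involutions in $\mathrm{GL}_{Cf}(\mathbb{F})$.
   Context: $\mathbb{N}$ is the set of non-negative integers. $\mathcal{M}_{Cf}(\mathbb{F})$ is the $\mathbb{F}$-algebra of column-finite matrices indexed over $\mathbb{N}$: families $(a_{i,j})_{(i,j)\in\mathbb{N}^2}$ of elements of $\mathbb{F}$ such that $\{i\in\mathbb{N}: a_{i,j}\neq 0\}$ is finite for all $j\in\mathbb{N}$, with entrywise linear operations and the usual matrix product. $I_{\mathbb{N}}$ is its unity and $\mathrm{GL}_{Cf}(\mathbb{F})$ its group of invertible elements. A matrix is strictly upper-triangular if $a_{i,j}=0$ for all $i\ge j$. An involution is an element $B$ with $B^2=I_{\mathbb{N}}$. *)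

theory Defs
  imports "HOL-Algebra.Ring"
begin

definition column_finite :: "(nat \<Rightarrow> nat \<Rightarrow> 'a::zero) \<Rightarrow> bool" where
  "column_finite A \<longleftrightarrow> (\<forall>j. finite {i. A i j \<noteq> 0})"

definition strictly_upper_triangular :: "(nat \<Rightarrow> nat \<Rightarrow> 'a::zero) \<Rightarrow> bool" where
  "strictly_upper_triangular A \<longleftrightarrow> (\<forall>i j. i \<ge> j \<longrightarrow> A i j = 0)"

text \<open>
  The usual matrix product, where the sum over all \<open>k\<close> is restricted to the support of the
  \<open>j\<close>-th column of \<open>B\<close>: the other terms vanish, and the support is finite when \<open>B\<close> is
  column-finite.
\<close>

definition cf_mult ::
    "(nat \<Rightarrow> nat \<Rightarrow> 'a::field) \<Rightarrow> (nat \<Rightarrow> nat \<Rightarrow> 'a) \<Rightarrow> nat \<Rightarrow> nat \<Rightarrow> 'a" where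
  "cf_mult A B = (\<lambda>i j. \<Sum>k | B k j \<noteq> 0. A i k * B k j)"

text \<open>
  The ring structure of the algebra of column-finite matrices; the record type has no field for
  scalar multiplication.
\<close>

definition M_Cf :: "(nat \<Rightarrow> nat \<Rightarrow> 'a::field) ring" where
  "M_Cf = \<lparr>carrier = {A. column_finite A},
           mult = cf_mult,
           one = (\<lambda>i j. if i = j then 1 else 0),
           zero = (\<lambda>i j. 0),
           add = (\<lambda>A B i j. A i j + B i j)\<rparr>"

abbreviation GL_Cf :: "(nat \<Rightarrow> nat \<Rightarrow> 'a::field) set" where
  "GL_Cf \<equiv> Units M_Cf"

definition involution :: "('r, 'm) monoid_scheme \<Rightarrow> 'r \<Rightarrow> bool" where
  "involution R B \<longleftrightarrow> B \<in> carrier R \<and> B \<otimes>\<^bsub>R\<^esub> B = \<one>\<^bsub>R\<^esub>"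

lemma cf_mult_superset:
  assumes "finite S" and "{k. B k j \<noteq> 0} \<subseteq> S"
  shows "cf_mult A B i j = (\<Sum>k\<in>S. A i k * B k j)"
  unfolding cf_mult_def using assms by (intro sum.mono_neutral_left) auto

lemma column_finiteD: "column_finite A \<Longrightarrow> finite {i. A i j \<noteq> 0}"
  by (simp add: column_finite_def)

lemma column_finite_add:
  fixes A B :: "nat \<Rightarrow> nat \<Rightarrow> 'a::field"
  assumes "column_finite A" and "column_finite B"
  shows "column_finite (\<lambda>i j. A i j + B i j)"
  unfolding column_finite_def
proof
  fix j
  have "{i. A i j + B i j \<noteq> 0} \<subseteq> {i. A i j \<noteq> 0} \<union> {i. B i j \<noteq> 0}" by auto
  then show "finite {i. A i j + B i j \<noteq> 0}"
    by (rule finite_subset) (use assms in \<open>simp add: column_finite_def\<close>)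
qed

lemma cf_mult_support:
  "{i. cf_mult A B i j \<noteq> 0} \<subseteq> (\<Union>k\<in>{k. B k j \<noteq> 0}. {i. A i k \<noteq> 0})"
proof
  fix i assume "i \<in> {i. cf_mult A B i j \<noteq> 0}"
  then have "(\<Sum>k | B k j \<noteq> 0. A i k * B k j) \<noteq> 0" by (simp add: cf_mult_def)
  then obtain k where "k \<in> {k. B k j \<noteq> 0}" and "A i k * B k j \<noteq> 0"
    using sum.not_neutral_contains_not_neutral by blast
  then show "i \<in> (\<Union>k\<in>{k. B k j \<noteq> 0}. {i. A i k \<noteq> 0})" by auto
qed

lemma finite_cf_mult_support:
  assumes "column_finite A" and "column_finite B"
  shows "finite (\<Union>k\<in>{k. B k j \<noteq> 0}. {i. A i k \<noteq> 0})"
  using assms by (auto simp: column_finite_def)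

lemma column_finite_mult:
  assumes "column_finite A" and "column_finite B"
  shows "column_finite (cf_mult A B)"
  unfolding column_finite_def
  by (intro allI finite_subset[OF cf_mult_support] finite_cf_mult_support assms)

lemma cf_mult_assoc:
  assumes B: "column_finite B" and C: "column_finite C"
  shows "cf_mult (cf_mult A B) C = cf_mult A (cf_mult B C)"
proof (intro ext)
  fix i j
  define T where "T = {l. C l j \<noteq> 0}"
  define S where "S = (\<Union>l\<in>T. {k. B k l \<noteq> 0})"
  have T: "finite T" using C by (simp add: T_def column_finiteD)
  have S: "finite S" unfolding S_def T_def by (rule finite_cf_mult_support[OF B C])
  have "cf_mult (cf_mult A B) C i j = (\<Sum>l\<in>T. cf_mult A B i l * C l j)"
    by (rule cf_mult_superset) (use T in \<open>auto simp: T_def\<close>)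
  also have "\<dots> = (\<Sum>l\<in>T. (\<Sum>k\<in>S. A i k * B k l) * C l j)"
    by (intro sum.cong refl arg_cong2[where f = "(*)"] cf_mult_superset[OF S])
       (auto simp: S_def)
  also have "\<dots> = (\<Sum>k\<in>S. A i k * (\<Sum>l\<in>T. B k l * C l j))"
    unfolding sum_distrib_left sum_distrib_right mult.assoc by (rule sum.swap)
  also have "\<dots> = (\<Sum>k\<in>S. A i k * cf_mult B C k j)"
    by (simp add: cf_mult_def T_def)
  also have "\<dots> = cf_mult A (cf_mult B C) i j"
    by (rule cf_mult_superset[symmetric])
       (use S cf_mult_support[of B C j] in \<open>simp_all add: S_def T_def\<close>)
  finally show "cf_mult (cf_mult A B) C i j = cf_mult A (cf_mult B C) i j" .
qed

lemma ring_M_Cf: "ring (M_Cf :: (nat \<Rightarrow> nat \<Rightarrow> 'a::field) ring)"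
proof (rule ringI)
  show "abelian_group (M_Cf :: (nat \<Rightarrow> nat \<Rightarrow> 'a) ring)"
  proof (rule abelian_groupI)
    fix A :: "nat \<Rightarrow> nat \<Rightarrow> 'a"
    assume "A \<in> carrier M_Cf"
    then show "\<exists>B\<in>carrier M_Cf. B \<oplus>\<^bsub>M_Cf\<^esub> A = \<zero>\<^bsub>M_Cf\<^esub>"
      by (intro bexI[of _ "\<lambda>i j. - A i j"]) (auto simp: M_Cf_def column_finite_def)
  qed (simp_all add: M_Cf_def column_finite_add add_ac,
       simp_all add: column_finite_def)
  show "monoid (M_Cf :: (nat \<Rightarrow> nat \<Rightarrow> 'a) ring)"
  proof (rule monoidI)
    fix A :: "nat \<Rightarrow> nat \<Rightarrow> 'a"
    assume "A \<in> carrier M_Cf"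
    then have A: "column_finite A" by (simp add: M_Cf_def)
    show "\<one>\<^bsub>M_Cf\<^esub> \<otimes>\<^bsub>M_Cf\<^esub> A = A"
    proof (intro ext)
      fix i j
      have "(\<Sum>k | A k j \<noteq> 0. (if i = k then 1 else 0) * A k j)
          = (\<Sum>k | A k j \<noteq> 0. if i = k then A k j else 0)"
        by (intro sum.cong) auto
      also have "\<dots> = A i j" using column_finiteD[OF A, of j] by simp
      finally show "(\<one>\<^bsub>M_Cf\<^esub> \<otimes>\<^bsub>M_Cf\<^esub> A) i j = A i j"
        by (simp add: M_Cf_def cf_mult_def)
    qed
    show "A \<otimes>\<^bsub>M_Cf\<^esub> \<one>\<^bsub>M_Cf\<^esub> = A"
      by (simp add: M_Cf_def cf_mult_def)
  qed (simp_all add: M_Cf_def column_finite_mult cf_mult_assoc,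
       simp_all add: column_finite_def)
next
  fix A B C :: "nat \<Rightarrow> nat \<Rightarrow> 'a"
  assume "A \<in> carrier M_Cf" "B \<in> carrier M_Cf" "C \<in> carrier M_Cf"
  then have A: "column_finite A" and B: "column_finite B" and C: "column_finite C"
    by (simp_all add: M_Cf_def)
  show "(A \<oplus>\<^bsub>M_Cf\<^esub> B) \<otimes>\<^bsub>M_Cf\<^esub> C = A \<otimes>\<^bsub>M_Cf\<^esub> C \<oplus>\<^bsub>M_Cf\<^esub> B \<otimes>\<^bsub>M_Cf\<^esub> C"
    by (simp add: M_Cf_def cf_mult_def ring_distribs sum.distrib)
  show "C \<otimes>\<^bsub>M_Cf\<^esub> (A \<oplus>\<^bsub>M_Cf\<^esub> B) = C \<otimes>\<^bsub>M_Cf\<^esub> A \<oplus>\<^bsub>M_Cf\<^esub> C \<otimes>\<^bsub>M_Cf\<^esub> B"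
  proof (intro ext)
    fix i j
    define S where "S = {k. A k j \<noteq> 0} \<union> {k. B k j \<noteq> 0}"
    have S: "finite S" using A B by (simp add: S_def column_finiteD)
    have "cf_mult C (\<lambda>i j. A i j + B i j) i j = (\<Sum>k\<in>S. C i k * (A k j + B k j))"
      by (rule cf_mult_superset[OF S]) (auto simp: S_def)
    also have "\<dots> = (\<Sum>k\<in>S. C i k * A k j) + (\<Sum>k\<in>S. C i k * B k j)"
      by (simp add: distrib_left sum.distrib)
    also have "(\<Sum>k\<in>S. C i k * A k j) = cf_mult C A i j"
      by (rule cf_mult_superset[symmetric, OF S]) (auto simp: S_def)
    also have "(\<Sum>k\<in>S. C i k * B k j) = cf_mult C B i j"
      by (rule cf_mult_superset[symmetric, OF S]) (auto simp: S_def)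
    finally show "(C \<otimes>\<^bsub>M_Cf\<^esub> (A \<oplus>\<^bsub>M_Cf\<^esub> B)) i j
        = (C \<otimes>\<^bsub>M_Cf\<^esub> A \<oplus>\<^bsub>M_Cf\<^esub> C \<otimes>\<^bsub>M_Cf\<^esub> B) i j"
      by (simp add: M_Cf_def)
  qed
qed

end

(* Identify the column-finite matrices with the endomorphisms of the space V of polynomials, A with
   a locally nilpotent t. If X is a basis of V with t X contained in X together with 0, and
   u = 1 + t, then the linear map B with B x = (-u)^d x, where d is the nilpotency index of x in X,
   satisfies u B u = B and B B = 1; hence B u is an involution too and u = B (B u).
   Such a basis is the analogue of the fact that countable abelian p-groups are simply presented.
   It is the union of an increasing sequence of finite t-closed independent sets whose span contains
   more and more of V; to keep the construction going, the (transfinite) height of a linear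
   combination of each of these sets must be the least height of the vectors involved. *)

theory Submission
  imports Defs "HOL-Computational_Algebra.Polynomial"
begin

locale endomorphism = vector_space scale
  for scale :: "'a::field \<Rightarrow> 'v::ab_group_add \<Rightarrow> 'v" (infixr "*s" 75) +
  fixes t :: "'v \<Rightarrow> 'v"
  assumes map_add: "t (x + y) = t x + t y"
    and map_scale: "t (c *s x) = c *s t x"
begin

lemma map_zero [simp]: "t 0 = 0"
  using map_scale[of 0 0] by simp

lemma map_diff: "t (x - y) = t x - t y"
  using map_add[of "x - y" y] by simp

lemma subspace_image: "subspace S \<Longrightarrow> subspace (t ` S)"
  by (auto simp: subspace_def simp flip: map_add map_scale intro: rev_image_eqI[of 0])

lemma map_span:
  assumes "n \<in> span A" and "t ` A \<subseteq> span B"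
  shows "t n \<in> span B"
proof -
  have "subspace {n. t n \<in> span B}"
    by (auto simp: subspace_def map_add map_scale intro: span_zero span_add span_scale)
  with assms show ?thesis
    using span_minimal[of A "{n. t n \<in> span B}"] by auto
qed

section \<open>Transfinite images as a measure of height\<close>

text \<open>
  The members of the tower are the images of the whole space under the transfinite iterates
  of \<open>t\<close>; membership in them measures heights without mentioning ordinals.
\<close>

inductive_set tower :: "'v set set" where
  image: "S \<in> tower \<Longrightarrow> t ` S \<in> tower"
| Inter: "(\<And>S. S \<in> M \<Longrightarrow> S \<in> tower) \<Longrightarrow> \<Inter>M \<in> tower"

lemma subspace_tower: "S \<in> tower \<Longrightarrow> subspace S"
  by (induction rule: tower.induct) (simp_all add: subspace_image subspace_Inter)

lemma image_tower_subset: "S \<in> tower \<Longrightarrow> t ` S \<subseteq> S"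
proof (induction rule: tower.induct)
  case (image S)
  then show ?case by (intro image_mono)
next
  case (Inter M)
  then show ?case by fast
qed

text \<open>Comparability alone does not survive the induction; this form also excludes members
  strictly between \<open>S\<close> and its image. The inductions on \<open>S\<close> and
  \<open>T\<close> are nested, as in the Bourbaki-Witt argument.\<close>

lemma tower_step:
  assumes "S \<in> tower" and "T \<in> tower"
  shows "T \<subseteq> t ` S \<or> S \<subseteq> T"
  using assms
proof (induction S arbitrary: T rule: tower.induct)
  case (image S)
  from image.prems show ?case
  proof (induction T rule: tower.induct)
    case (image T)
    then show ?case using image.hyps \<open>\<And>T. T \<in> tower \<Longrightarrow> T \<subseteq> t ` S \<or> S \<subseteq> T\<close> by blast
  next
    case (Inter M)
    then show ?case by blast
  qed
next
  case (Inter M)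
  note IH = Inter.IH
  from Inter.prems show ?case
  proof (induction T rule: tower.induct)
    case (image T)
    show ?case
    proof (cases "T \<subseteq> t ` \<Inter>M \<or> T \<subseteq> \<Inter>M")
      case True
      with image.IH image_tower_subset[OF image.hyps] show ?thesis by blast
    next
      case False
      then obtain S where S: "S \<in> M" "\<not> T \<subseteq> S" by blast
      with Inter.hyps have "S \<in> tower" by blast
      with S IH[OF S(1) image.hyps] image_tower_subset have "S \<subseteq> T" by blast
      show ?thesis
      proof (cases "\<exists>S'\<in>M. S' \<subseteq> t ` S")
        case True
        with \<open>S \<subseteq> T\<close> show ?thesis by blast
      next
        \<comment> \<open>Now \<open>S\<close> is the least member of \<open>M\<close>, hence its
          intersection, and the induction hypothesis for \<open>S\<close> settles the claim.\<close>
        case False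
        with IH[OF S(1)] Inter.hyps have "\<Inter>M = S" using S(1) by blast
        with IH[OF S(1)] tower.image[OF image.hyps] show ?thesis by simp
      qed
    qed
  next
    case (Inter M')
    then show ?case by blast
  qed
qed

lemma tower_linear:
  assumes "S \<in> tower" and "T \<in> tower"
  shows "T \<subseteq> S \<or> S \<subseteq> T"
  using tower_step[OF assms] image_tower_subset[OF assms(1)] by blast

section \<open>Adapted sets and proper vectors\<close>

text \<open>
  The last condition says that the height of a linear combination of \<open>X\<close> is the least height
  of the vectors involved.
\<close>

definition adapted :: "'v set \<Rightarrow> bool" where
  "adapted X \<longleftrightarrow> finite X \<and> independent X \<and> (\<forall>x\<in>X. t x \<in> insert 0 X) \<and>
     (\<forall>W\<in>tower. span X \<inter> W \<subseteq> span (X \<inter> W))"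

text \<open>\<open>v\<close> has the largest height in its coset modulo \<open>span X\<close>, and that height is \<open>S\<close>.\<close>

definition proper :: "'v set \<Rightarrow> 'v set \<Rightarrow> 'v \<Rightarrow> bool" where
  "proper X S v \<longleftrightarrow> S \<in> tower \<and> v \<in> S \<and>
     (\<forall>W\<in>tower. W \<subset> S \<longrightarrow> (\<forall>n\<in>span X. v + n \<notin> W))"

lemma adapted_empty: "adapted {}"
  by (simp add: adapted_def independent_empty)

lemma adapted_map: "adapted X \<Longrightarrow> x \<in> X \<Longrightarrow> t x \<in> insert 0 X"
  by (simp add: adapted_def)

lemma adapted_span_Int:
  "adapted X \<Longrightarrow> W \<in> tower \<Longrightarrow> n \<in> span X \<Longrightarrow> n \<in> W \<Longrightarrow> n \<in> span (X \<inter> W)"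
  by (auto simp: adapted_def)

lemma adapted_map_span: "adapted X \<Longrightarrow> n \<in> span X \<Longrightarrow> t n \<in> span X"
  by (erule map_span) (auto dest!: adapted_map simp: span_base span_zero)

lemma adapted_cancel:
  assumes X: "adapted X" and W: "W \<in> tower" and "x \<in> X" "c \<noteq> 0"
    and r: "r \<in> span (X - {x})" and in_W: "c *s x + r \<in> W"
  shows "x \<in> W"
proof (rule ccontr)
  assume "x \<notin> W"
  have "c *s x + r \<in> span X"
    using \<open>x \<in> X\<close> r by (meson Diff_subset in_mono span_add span_base span_mono span_scale)
  then have "c *s x + r \<in> span (X \<inter> W)"
    using adapted_span_Int X W in_W by blast
  also have "\<dots> \<subseteq> span (X - {x})"
    using \<open>x \<notin> W\<close> by (intro span_mono) auto
  finally have "c *s x \<in> span (X - {x})"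
    using r span_add_eq2 by blast
  then have "x \<in> span (X - {x})"
    using \<open>c \<noteq> 0\<close> by (metis span_scale scale_scale left_inverse scale_one)
  then show False
    using X \<open>x \<in> X\<close> by (auto simp: adapted_def dependent_def)
qed

text \<open>As \<open>t\<close> maps \<open>X\<close> into \<open>X\<close> and 0, an
  \<open>x\<close>-coordinate of \<open>t n\<close> can only come from preimages of \<open>x\<close>
  in \<open>X\<close>.\<close>

lemma map_span_avoiding:
  assumes "adapted X" and "n \<in> span (X \<inter> S)" and "\<forall>y\<in>X \<inter> S. t y \<noteq> x"
  shows "t n \<in> span (X - {x})"
proof (rule map_span[OF assms(2)], rule image_subsetI)
  fix y assume "y \<in> X \<inter> S"
  with assms have "t y \<in> insert 0 (X - {x})"
    using adapted_map[OF assms(1), of y] by auto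
  then show "t y \<in> span (X - {x})" by (metis insertE span_base span_zero)
qed

text \<open>Let \<open>c *s y + n\<close> lie in \<open>W\<close>. If \<open>y\<close> does not,
  then \<open>W\<close> is strictly inside \<open>S\<close> by comparability, and dividing by a
  nonzero \<open>c\<close> would contradict properness. So both summands lie in
  \<open>W\<close>.\<close>

lemma adapted_insert:
  assumes X: "adapted X" and y: "proper X S y" "y \<notin> span X" "t y \<in> insert 0 X"
  shows "adapted (insert y X)"
proof -
  have "span (insert y X) \<inter> W \<subseteq> span (insert y X \<inter> W)" if W: "W \<in> tower" for W
  proof
    fix w assume w: "w \<in> span (insert y X) \<inter> W"
    then obtain c where n: "w - c *s y \<in> span X" by (auto simp: span_insert)
    have W_sub: "subspace W" using W by (rule subspace_tower)
    have "c = 0 \<or> y \<in> W"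
    proof (rule disjCI)
      assume "y \<notin> W"
      with y(1) have "\<not> S \<subseteq> W" "S \<in> tower" by (auto simp: proper_def)
      then have "W \<subset> S" using tower_linear[OF W, of S] by blast
      show "c = 0"
      proof (rule ccontr)
        assume "c \<noteq> 0"
        then have "y + inverse c *s (w - c *s y) = inverse c *s w"
          by (simp add: scale_right_diff_distrib)
        moreover have "inverse c *s w \<in> W"
          using w W_sub by (simp add: subspace_scale)
        moreover have "inverse c *s (w - c *s y) \<in> span X" using n by (rule span_scale)
        ultimately show False using y(1) W \<open>W \<subset> S\<close> unfolding proper_def by metis
      qed
    qed
    then have cy: "c *s y \<in> W" "c *s y \<in> span (insert y X \<inter> W)"
      using W_sub by (auto simp: subspace_scale subspace_0 span_zero intro: span_scale span_base)
    then have "w - c *s y \<in> W" using w W_sub by (simp add: subspace_diff)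
    then have "w - c *s y \<in> span (X \<inter> W)" using adapted_span_Int X W n by blast
    then have "w - c *s y \<in> span (insert y X \<inter> W)"
      using span_mono[of "X \<inter> W" "insert y X \<inter> W"] by blast
    from span_add[OF this cy(2)] show "w \<in> span (insert y X \<inter> W)" by simp
  qed
  with X y show ?thesis by (auto simp: adapted_def independent_insert)
qed

text \<open>Every member of \<open>G\<close> meets the coset of \<open>v\<close>, but their
  intersection must do so too. Finiteness of \<open>X\<close> ensures it: below a \<open>W\<close>
  with \<open>card (X \<inter> W)\<close> least the trace on \<open>X\<close> is constant, so a
  single representative lies in all members.\<close>

lemma proper_exists:
  assumes X: "adapted X"
  obtains n S where "n \<in> span X" and "proper X S (v + n)"
proof -
  define G where "G = {W\<in>tower. \<exists>n\<in>span X. v + n \<in> W}"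
  \<comment> \<open>The empty intersection is the whole space, so \<open>G\<close> is
    nonempty.\<close>
  have "\<Inter>{} \<in> G" unfolding G_def using tower.Inter[of "{}"] span_zero by auto
  then obtain W where W: "W \<in> G" and min: "\<And>W'. W' \<in> G \<Longrightarrow> card (X \<inter> W) \<le> card (X \<inter> W')"
    using ex_has_least_nat[of "\<lambda>W. W \<in> G" _ "\<lambda>W. card (X \<inter> W)"] by blast
  from W obtain n where n: "n \<in> span X" "v + n \<in> W" "W \<in> tower" by (auto simp: G_def)
  have "v + n \<in> W'" if W': "W' \<in> G" for W'
  proof (cases "W \<subseteq> W'")
    case True
    with n show ?thesis by blast
  next
    case False
    with W' n(3) have sub: "W' \<subseteq> W" using tower_linear[of W W'] by (auto simp: G_def)
    from W' obtain n' where n': "n' \<in> span X" "v + n' \<in> W'" "W' \<in> tower" by (auto simp: G_def)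
    have "(v + n) - (v + n') \<in> W"
      using n n' sub by (intro subspace_diff subspace_tower) auto
    then have "n - n' \<in> span (X \<inter> W)"
      using adapted_span_Int[OF X n(3), of "n - n'"] n n' by (simp add: span_diff)
    moreover have "X \<inter> W' = X \<inter> W"
      using sub min[OF W'] X by (intro card_seteq) (auto simp: adapted_def)
    ultimately have "n - n' \<in> W'"
      using span_minimal[OF _ subspace_tower[OF n'(3)], of "X \<inter> W'"] by auto
    from subspace_add[OF subspace_tower[OF n'(3)] n'(2) this] show ?thesis by simp
  qed
  moreover have "\<Inter>G \<in> tower" by (rule tower.Inter) (simp add: G_def)
  moreover have "v + n + n' \<notin> U" if U: "U \<in> tower" "U \<subset> \<Inter>G" and n': "n' \<in> span X" for U n'
  proof
    assume "v + n + n' \<in> U"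
    then have "U \<in> G" using U n n' by (auto simp: G_def add.assoc intro: span_add)
    with U(2) show False by blast
  qed
  ultimately have "proper X (\<Inter>G) (v + n)" by (auto simp: proper_def)
  with n(1) show ?thesis by (rule that)
qed

section \<open>Extending adapted sets\<close>

text \<open>
  The preimage \<open>y\<close> of \<open>x\<close> is chosen so high that the vectors of \<open>X\<close> at least as high as
  \<open>y\<close> belong to every \<open>T\<close> in the tower with \<open>x \<in> t ` T\<close>. This makes \<open>y\<close> proper even
  when the height of \<open>x\<close> is a limit, so that \<open>x\<close> has no highest preimage.
\<close>

lemma adjoin_preimage:
  assumes X: "adapted X" and x: "x \<in> X" and W: "W \<in> tower" "x \<in> t ` W"
    and nopre: "\<forall>y\<in>X \<inter> W. t y \<noteq> x"
  obtains y where "y \<in> W" and "t y = x" and "adapted (insert y X)"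
proof -
  define G where "G = {T\<in>tower. x \<in> t ` T}"
  have "W \<in> G" using W by (simp add: G_def)
  then obtain T where "T \<in> G \<and> T \<subseteq> W"
    and min: "\<And>T'. T' \<in> G \<and> T' \<subseteq> W \<Longrightarrow> card (X \<inter> T) \<le> card (X \<inter> T')"
    using ex_has_least_nat[of "\<lambda>T. T \<in> G \<and> T \<subseteq> W" W "\<lambda>T. card (X \<inter> T)"] by blast
  then have T: "T \<in> G" "T \<subseteq> W" by auto
  have same: "X \<inter> T' = X \<inter> T" if "T' \<in> G" "T' \<subseteq> T" for T'
    using that T min[of T'] X by (intro card_seteq) (auto simp: adapted_def)
  from T obtain y where y: "y \<in> T" "t y = x" by (auto simp: G_def)
  define S where "S = \<Inter>{U\<in>tower. y \<in> U}"
  have S: "S \<in> tower" "y \<in> S" "S \<subseteq> T" "x \<in> t ` S"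
    using y T by (auto simp: S_def G_def intro!: tower.Inter)
  have x_notin: "x \<notin> span (X - {x})" using X x by (auto simp: adapted_def dependent_def)
  have avoid: "t n \<in> span (X - {x})" if "n \<in> span X" "n \<in> S" for n
    using map_span_avoiding[OF X adapted_span_Int[OF X S(1)]] that S(3) T(2) nopre by blast
  have "y \<notin> span X" using avoid[of y] S(2) y(2) x_notin by blast
  have "y + n \<notin> U" if U: "U \<in> tower" "U \<subset> S" and n: "n \<in> span X" for U n
  proof
    assume yn: "y + n \<in> U"
    then have "y + n - y \<in> S"
      using U S by (intro subspace_diff subspace_tower) auto
    then have "n \<in> S" by simp
    \<comment> \<open>Since \<open>t n\<close> has no \<open>x\<close>-coordinate, \<open>x\<close>
      itself lies in the image of \<open>U\<close>. So \<open>U\<close> is in \<open>G\<close>, and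
      minimality of \<open>T\<close> forces the same trace on \<open>X\<close>.\<close>
    have "x + t n \<in> t ` U" using yn y(2) by (metis imageI map_add)
    then have "x \<in> t ` U"
      using adapted_cancel[OF X tower.image[OF U(1)] x, of 1 "t n"] avoid n \<open>n \<in> S\<close> by auto
    then have "X \<inter> U = X \<inter> S"
      using same[of U] same[of S] U S by (auto simp: G_def)
    then have "n \<in> span (X \<inter> U)" using adapted_span_Int[OF X S(1) n \<open>n \<in> S\<close>] by simp
    then have "n \<in> U" using span_minimal[OF _ subspace_tower[OF U(1)], of "X \<inter> U"] by auto
    then have "y + n - n \<in> U" using yn U by (intro subspace_diff subspace_tower)
    then have "S \<subseteq> U" using U(1) by (auto simp: S_def)
    with U(2) show False by blast
  qed
  then have "proper X S y" using S by (auto simp: proper_def)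
  then have "adapted (insert y X)"
    using \<open>y \<notin> span X\<close> y(2) x by (intro adapted_insert[OF X]) auto
  with y T that show ?thesis by blast
qed

text \<open>
  The hypothesis on \<open>Z\<close> says that its vectors have height exactly one more than \<open>S\<close> and have
  no preimage of height \<open>S\<close> in \<open>X\<close>. Preimages are adjoined for all of them but one, for which
  \<open>v\<close> itself provides a preimage.
\<close>

lemma extend_tight:
  assumes "finite Z" "Z \<noteq> {}"
    and "adapted X" "Z \<subseteq> X" "S \<in> tower" "v \<in> S"
    and "t v = (\<Sum>x\<in>Z. a x *s x)" "\<forall>x\<in>Z. a x \<noteq> 0"
    and "\<forall>x\<in>Z. (\<forall>y\<in>X \<inter> S. t y \<noteq> x) \<and> (\<forall>W\<in>tower. W \<subset> S \<longrightarrow> x \<notin> t ` W)"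
  shows "\<exists>X'. adapted X' \<and> X \<subseteq> X' \<and> v \<in> span X'"
  using assms
proof (induction Z arbitrary: X v rule: finite_ne_induct)
  case (singleton x)
  then have x: "x \<in> X" "t v = a x *s x" "a x \<noteq> 0" by auto
  let ?y = "inverse (a x) *s v"
  have X: "adapted X" by fact
  have S: "S \<in> tower" by fact
  have y: "?y \<in> S" "t ?y = x"
    using singleton x subspace_scale[OF subspace_tower[OF S]] by (auto simp: map_scale)
  have v: "v = a x *s ?y" using x(3) by simp
  show ?case
  proof (cases "?y \<in> span X")
    case True
    then have "v \<in> span X" using v by (metis span_scale)
    with X show ?thesis by blast
  next
    case False
    \<comment> \<open>Otherwise \<open>n\<close> lies in \<open>S\<close>, \<open>t n\<close> has no
      \<open>x\<close>-coordinate, and \<open>x\<close> lies in the image of \<open>W\<close>, which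
      tightness excludes.\<close>
    have "?y + n \<notin> W" if W: "W \<in> tower" "W \<subset> S" and n: "n \<in> span X" for W n
    proof
      assume yn: "?y + n \<in> W"
      then have "?y + n - ?y \<in> S"
        using W y S by (intro subspace_diff subspace_tower) auto
      then have "n \<in> span (X \<inter> S)" using adapted_span_Int[OF X S n] by simp
      then have "t n \<in> span (X - {x})"
        using map_span_avoiding[OF X] singleton.prems by auto
      moreover have "1 *s x + t n \<in> t ` W" using yn y(2) by (metis imageI map_add scale_one)
      ultimately have "x \<in> t ` W"
        using adapted_cancel[OF X tower.image[OF W(1)] x(1)] one_neq_zero by blast
      with W singleton.prems show False by auto
    qed
    then have "proper X S ?y" using S y by (auto simp: proper_def)
    then have "adapted (insert ?y X)"
      using False y x by (intro adapted_insert[OF X]) auto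
    moreover have "v \<in> span (insert ?y X)" using v by (metis insertI1 span_base span_scale)
    ultimately show ?thesis by blast
  qed
next
  case (insert x Z)
  have X: "adapted X" and S: "S \<in> tower" by fact+
  have x: "x \<in> X" "a x \<noteq> 0" using insert.prems by auto
  have tv: "t v = a x *s x + (\<Sum>x\<in>Z. a x *s x)" using insert by simp
  have "(\<Sum>x\<in>Z. a x *s x) \<in> span (X - {x})"
    using insert.prems insert.hyps by (intro span_sum span_scale span_base) auto
  then have "x \<in> t ` S"
    using adapted_cancel[OF X tower.image[OF S] x] tv insert.prems(4)
    by (metis (no_types, lifting) imageI)
  then obtain y where y: "y \<in> S" "t y = x" "adapted (insert y X)"
    using adjoin_preimage[OF X x(1) S] insert.prems by auto
  have "\<exists>X'. adapted X' \<and> insert y X \<subseteq> X' \<and> v - a x *s y \<in> span X'"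
  proof (rule insert.IH)
    show "v - a x *s y \<in> S"
      using insert.prems y S by (intro subspace_diff subspace_scale subspace_tower) auto
    show "t (v - a x *s y) = (\<Sum>x\<in>Z. a x *s x)" by (simp add: map_diff map_scale y tv)
  qed (use insert.prems insert.hyps y in auto)
  then obtain X' where X': "adapted X'" "insert y X \<subseteq> X'" "v - a x *s y \<in> span X'" by blast
  then have "v - a x *s y + a x *s y \<in> span X'"
    by (intro span_add[OF _ span_scale[OF span_base]]) auto
  with X' show ?case by auto
qed

text \<open>A vector \<open>x\<close> is removed from the support \<open>Z\<close> of
  \<open>t v\<close> by subtracting from \<open>v\<close> a multiple of a preimage of
  \<open>x\<close> in \<open>S\<close>, either present in \<open>X\<close> or adjoined inside a
  smaller \<open>W\<close>; both keep \<open>v\<close> proper. If no \<open>x\<close> admits this,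
  \<open>extend_tight\<close> applies or \<open>t v = 0\<close>.\<close>

lemma extend_proper:
  assumes "finite Z" and "adapted X" "Z \<subseteq> X" "proper X S v"
    and "t v = (\<Sum>x\<in>Z. a x *s x)" "\<forall>x\<in>Z. a x \<noteq> 0"
  shows "\<exists>X'. adapted X' \<and> X \<subseteq> X' \<and> v \<in> span X'"
  using assms
proof (induction Z arbitrary: X v rule: finite_psubset_induct)
  case (psubset Z)
  have X: "adapted X" and v: "proper X S v" by fact+
  have S: "S \<in> tower" "v \<in> S" using v by (auto simp: proper_def)
  have reduce: ?case
    if X': "adapted X'" "X \<subseteq> X'" "proper X' S v" and x: "x \<in> Z" and y: "y \<in> X'" "y \<in> S" "t y = x"
    for X' x y
  proof -
    have "\<exists>X''. adapted X'' \<and> X' \<subseteq> X'' \<and> v - a x *s y \<in> span X''"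
    proof (rule psubset.IH[of "Z - {x}"])
      show "t (v - a x *s y) = (\<Sum>x\<in>Z - {x}. a x *s x)"
        using psubset x y by (simp add: map_diff map_scale sum_diff1)
      have "v - a x *s y \<in> S"
        using S y by (intro subspace_diff subspace_scale subspace_tower) auto
      moreover have "v - a x *s y + n \<notin> W" if "W \<in> tower" "W \<subset> S" "n \<in> span X'" for W n
      proof -
        have "n - a x *s y \<in> span X'"
          using that(3) y(1) by (simp add: span_diff span_scale span_base)
        with X'(3) that have "v + (n - a x *s y) \<notin> W" unfolding proper_def by blast
        then show ?thesis by (simp add: algebra_simps)
      qed
      ultimately show "proper X' S (v - a x *s y)" using S by (auto simp: proper_def)
    qed (use psubset.prems X' x in auto)
    then obtain X'' where X'': "adapted X''" "X' \<subseteq> X''" "v - a x *s y \<in> span X''" by blast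
    then have "v - a x *s y + a x *s y \<in> span X''"
      using y(1) by (intro span_add[OF _ span_scale[OF span_base]]) auto
    with X'' X'(2) show ?thesis by auto
  qed
  consider
      (preimage) x y where "x \<in> Z" "y \<in> X \<inter> S" "t y = x"
    | (high) x W where "x \<in> Z" "\<forall>y\<in>X \<inter> S. t y \<noteq> x" "W \<in> tower" "W \<subset> S" "x \<in> t ` W"
    | (tight) "\<forall>x\<in>Z. (\<forall>y\<in>X \<inter> S. t y \<noteq> x) \<and> (\<forall>W\<in>tower. W \<subset> S \<longrightarrow> x \<notin> t ` W)"
    by blast
  then show ?case
  proof cases
    case preimage
    then show ?thesis using reduce[of X x y] X v by auto
  next
    case high
    have "x \<in> X" "\<forall>y\<in>X \<inter> W. t y \<noteq> x" using high psubset.prems by auto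
    then obtain y where y: "y \<in> W" "t y = x" "adapted (insert y X)"
      using adjoin_preimage[OF X _ high(3,5)] by blast
    have "v + n \<notin> U" if U: "U \<in> tower" "U \<subset> S" and n: "n \<in> span (insert y X)" for U n
    proof
      assume vn: "v + n \<in> U"
      from n obtain c where c: "n - c *s y \<in> span X" by (auto simp: span_insert)
      \<comment> \<open>The larger of \<open>U\<close> and \<open>W\<close> contains the multiple of
        \<open>y\<close> and is still strictly inside \<open>S\<close>.\<close>
      define U' where "U' = U \<union> W"
      have "U' = U \<or> U' = W" using tower_linear[OF U(1) high(3)] by (auto simp: U'_def)
      then have U': "U' \<in> tower" "U' \<subset> S" using U high by auto
      have "v + n - c *s y \<in> U'"
        using vn y by (intro subspace_diff subspace_scale subspace_tower U') (auto simp: U'_def)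
      then have "v + (n - c *s y) \<in> U'" by (simp add: algebra_simps)
      with v U' c show False by (auto simp: proper_def)
    qed
    then have "proper (insert y X) S v" using S by (auto simp: proper_def)
    then show ?thesis using reduce[of "insert y X" x y] y high by auto
  next
    case tight
    show ?thesis
    proof (cases "Z = {}")
      case False
      then show ?thesis using extend_tight[OF _ False X] psubset S tight by blast
    next
      case True
      then have "t v = 0" using psubset.prems by simp
      show ?thesis
      proof (cases "v \<in> span X")
        case False
        then have "adapted (insert v X)" using \<open>t v = 0\<close> by (intro adapted_insert[OF X v]) auto
        then show ?thesis using span_base[of v "insert v X"] by blast
      qed (use X in blast)
    qed
  qed
qed

text \<open>Modulo \<open>span X\<close>, \<open>v\<close> may be replaced by a vector of largest
  height in its coset.\<close>

lemma extend_adapted: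
  assumes X: "adapted X" and tv: "t v \<in> span X"
  shows "\<exists>X'. adapted X' \<and> X \<subseteq> X' \<and> v \<in> span X'"
proof -
  obtain n S where n: "n \<in> span X" and proper: "proper X S (v + n)"
    by (rule proper_exists[OF X])
  have "t (v + n) \<in> span X" using tv adapted_map_span[OF X n] by (simp add: map_add span_add)
  then obtain a where a: "t (v + n) = (\<Sum>x\<in>X. a x *s x)"
    using X by (auto simp: span_finite adapted_def)
  also have "\<dots> = (\<Sum>x\<in>{x\<in>X. a x \<noteq> 0}. a x *s x)"
    using X by (intro sum.mono_neutral_right) (auto simp: adapted_def)
  finally have "\<exists>X'. adapted X' \<and> X \<subseteq> X' \<and> v + n \<in> span X'"
    using X by (intro extend_proper[OF _ X _ proper]) (auto simp: adapted_def)
  then obtain X' where X': "adapted X'" "X \<subseteq> X'" "v + n \<in> span X'" by blast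
  then have "v + n - n \<in> span X'" using n span_mono by (intro span_diff) auto
  with X' show ?thesis by auto
qed

section \<open>A basis on which \<open>t\<close> acts as a forest\<close>

text \<open>Triangularity lets the vectors \<open>e n\<close> be absorbed one at a time:
  \<open>t (e n)\<close> already lies in the span reached.\<close>

lemma forest_basis_exists:
  fixes e :: "nat \<Rightarrow> 'v"
  assumes e: "\<And>n. t (e n) \<in> span (e ` {..<n})" and span_e: "span (range e) = UNIV"
  obtains X where "independent X" "span X = UNIV" "\<And>x. x \<in> X \<Longrightarrow> t x \<in> insert 0 X"
proof -
  have "\<exists>X. \<forall>n. (adapted (X n) \<and> e ` {..<n} \<subseteq> span (X n)) \<and> X n \<subseteq> X (Suc n)"
  proof (rule dependent_nat_choice[where P = "\<lambda>n X. adapted X \<and> e ` {..<n} \<subseteq> span X"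
        and Q = "\<lambda>_ X X'. X \<subseteq> X'"])
    show "\<exists>X. adapted X \<and> e ` {..<0} \<subseteq> span X" using adapted_empty by auto
  next
    fix X n assume X: "adapted X \<and> e ` {..<n} \<subseteq> span X"
    then have "t (e n) \<in> span X"
      using e[of n] span_minimal[OF _ subspace_span, of "e ` {..<n}" X] by blast
    with X obtain X' where X': "adapted X'" "X \<subseteq> X'" "e n \<in> span X'"
      using extend_adapted[of X "e n"] by blast
    then have "e ` {..<Suc n} \<subseteq> span X'"
      using X span_mono[of X X'] by (auto simp: lessThan_Suc)
    with X' show "\<exists>X'. (adapted X' \<and> e ` {..<Suc n} \<subseteq> span X') \<and> X \<subseteq> X'" by blast
  qed
  then obtain X where X: "\<And>n. adapted (X n)" "\<And>n. e ` {..<n} \<subseteq> span (X n)"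
    "\<And>n. X n \<subseteq> X (Suc n)" by blast
  have "independent (\<Union>(range X))"
  proof (rule independent_Union_directed)
    fix c d assume "c \<in> range X" "d \<in> range X"
    then show "c \<subseteq> d \<or> d \<subseteq> c"
      using lift_Suc_mono_le[of X, OF X(3)] by (metis image_iff nle_le)
  qed (use X(1) in \<open>auto simp: adapted_def\<close>)
  moreover have "span (\<Union>(range X)) = UNIV"
  proof -
    have "e n \<in> span (\<Union>(range X))" for n
      using X(2)[of "Suc n"] span_mono[of "X (Suc n)" "\<Union>(range X)"] by blast
    then show ?thesis using span_minimal[OF _ subspace_span, of "range e"] span_e by blast
  qed
  moreover have "t x \<in> insert 0 (\<Union>(range X))" if "x \<in> \<Union>(range X)" for x
    using that adapted_map[OF X(1)] by auto
  ultimately show ?thesis by (rule that)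
qed

section \<open>Local nilpotency and the involution\<close>

lemma map_funpow_add: "(t ^^ n) (x + y) = (t ^^ n) x + (t ^^ n) y"
  by (induction n) (simp_all add: map_add)

lemma map_funpow_scale: "(t ^^ n) (c *s x) = c *s (t ^^ n) x"
  by (induction n) (simp_all add: map_scale)

lemma map_funpow_zero [simp]: "(t ^^ n) 0 = 0"
  by (induction n) simp_all

lemma funpow_eq_0_mono: "(t ^^ n) x = 0 \<Longrightarrow> n \<le> m \<Longrightarrow> (t ^^ m) x = 0"
  using Nat.funpow_add[of "m - n" n t] by simp

lemma subspace_nilpotent: "subspace {v. \<exists>n. (t ^^ n) v = 0}"
proof -
  have "\<exists>k. (t ^^ k) (x + y) = 0" if "(t ^^ n) x = 0" "(t ^^ m) y = 0" for x y n m
    using funpow_eq_0_mono[OF that(1), of "max n m"] funpow_eq_0_mono[OF that(2), of "max n m"]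
    by (intro exI[of _ "max n m"]) (simp add: map_funpow_add)
  moreover have "\<exists>k. (t ^^ k) (c *s x) = 0" if "(t ^^ n) x = 0" for c x n
    using that by (auto simp: map_funpow_scale intro: exI[of _ n])
  ultimately show ?thesis by (auto simp: subspace_def)
qed

lemma locally_nilpotent:
  fixes e :: "nat \<Rightarrow> 'v"
  assumes e: "\<And>n. t (e n) \<in> span (e ` {..<n})" and span_e: "span (range e) = UNIV"
  shows "\<exists>n. (t ^^ n) v = 0"
proof -
  let ?N = "{v. \<exists>n. (t ^^ n) v = 0}"
  have "e n \<in> ?N" for n
  proof (induction n rule: less_induct)
    case (less n)
    then have "t (e n) \<in> ?N"
      using e[of n] span_minimal[OF _ subspace_nilpotent, of "e ` {..<n}"] by blast
    then obtain k where "(t ^^ k) (t (e n)) = 0" by blast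
    then have "(t ^^ Suc k) (e n) = 0" by (simp add: funpow_swap1)
    then show ?case by blast
  qed
  then show ?thesis using span_minimal[OF _ subspace_nilpotent, of "range e"] span_e by blast
qed

text \<open>
  With \<open>w = - (1 + t)\<close> and a basis \<open>X\<close> as in \<open>forest_basis_exists\<close>, the involution is
  \<open>B x = w ^ d x\<close> for \<open>x \<in> X\<close> of nilpotency index \<open>d\<close>. It is semilinear for the substitution
  \<open>t \<mapsto> (1 + t)\<inverse> - 1 = w\<inverse> t\<close>, which maps \<open>w\<close> to its inverse.
\<close>

lemma involution_exists:
  fixes e :: "nat \<Rightarrow> 'v"
  assumes e: "\<And>n. t (e n) \<in> span (e ` {..<n})" and span_e: "span (range e) = UNIV"
  obtains B where "Vector_Spaces.linear scale scale B" "\<And>v. B (B v) = v"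
    "\<And>v. B (B (v + t v) + t (B (v + t v))) = v"
proof -
  note nilpotent = locally_nilpotent[OF e span_e]
  obtain X where X: "independent X" "span X = UNIV" "\<And>x. x \<in> X \<Longrightarrow> t x \<in> insert 0 X"
    using forest_basis_exists[OF e span_e] by blast
  interpret pair: vector_space_pair scale scale ..
  define d where "d x = (LEAST n. (t ^^ n) x = 0)" for x
  define w where "w v = - (v + t v)" for v
  have d_map: "d x = Suc (d (t x))" if "x \<noteq> 0" for x
  proof -
    obtain n where "(t ^^ n) x = 0" using nilpotent by blast
    from Least_Suc[of "\<lambda>n. (t ^^ n) x = 0", OF this] that show ?thesis
      by (simp add: d_def funpow_swap1)
  qed
  have map_minus: "t (- v) = - t v" for v using map_diff[of 0 v] by simp
  have pow_minus: "(t ^^ n) (- v) = - (t ^^ n) v" for n v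
    by (induction n) (simp_all add: map_minus)
  have w_zero: "(w ^^ n) 0 = 0" for n by (induction n) (simp_all add: w_def)
  have t_w: "t ((w ^^ n) v) = (w ^^ n) (t v)" for n v
    by (induction n) (simp_all add: w_def map_minus map_add map_diff)
  have inj_w: "a = b" if "w a = w b" for a b
  proof -
    have "t (a - b) = - (a - b)" using that by (simp add: w_def map_diff algebra_simps)
    \<comment> \<open>Here the powers of \<open>t\<close> only change the sign of \<open>v\<close>,
      so one of them can vanish only at 0.\<close>
    moreover have "v = 0" if "t v = - v" "(t ^^ n) v = 0" for n v
      using that by (induction n) (auto simp: pow_minus funpow_swap1)
    ultimately have "a - b = 0" using nilpotent[of "a - b"] by blast
    then show ?thesis by simp
  qed
  have inj_w_pow: "a = b" if "(w ^^ n) a = (w ^^ n) b" for n a b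
    using that by (induction n) (auto dest: inj_w)
  obtain B where B: "Vector_Spaces.linear scale scale B" "\<And>x. x \<in> X \<Longrightarrow> B x = (w ^^ d x) x"
    using pair.linear_independent_extend[OF X(1), of "\<lambda>x. (w ^^ d x) x"] by blast
  from B(1) have B_add: "B (x + y) = B x + B y" and B_scale: "B (c *s x) = c *s B x" for x y c
    by (simp_all add: Vector_Spaces.linear_iff)
  have B_zero: "B 0 = 0" using B_scale[of 0 0] by simp
  have B_minus: "B (- v) = - B v" for v
    using B_add[of v "- v"] B_zero by (simp add: eq_neg_iff_add_eq_0 add.commute)
  have "w (B (t v)) = t (B v)" for v
  proof (rule pair.linear_eq_on[of "\<lambda>v. w (B (t v))" "\<lambda>v. t (B v)" v X])
    show "Vector_Spaces.linear scale scale (\<lambda>v. w (B (t v)))"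
      "Vector_Spaces.linear scale scale (\<lambda>v. t (B v))"
      by (simp_all add: Vector_Spaces.linear_iff vector_space_axioms w_def map_add map_scale
          B_add B_scale scale_right_diff_distrib)
    show "v \<in> span X" using X(2) by simp
    fix x assume x: "x \<in> X"
    show "w (B (t x)) = t (B x)"
    proof (cases "t x = 0")
      case True
      then show ?thesis using B(2)[OF x] w_zero[of 1] by (simp add: B_zero t_w w_zero)
    next
      \<comment> \<open>\<open>B (t x)\<close> has one factor \<open>w\<close> fewer than
        \<open>B x\<close>, as \<open>d x = Suc (d (t x))\<close>; the outer \<open>w\<close>
        supplies it.\<close>
      case False
      then have "t x \<in> X" "x \<noteq> 0" using X(3)[OF x] by auto
      then show ?thesis using B(2) x t_w[of "d x" x] by (simp add: d_map[of x])
    qed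
  qed
  then have wBt: "- (B (t v) + t (B (t v))) = t (B v)" for v by (simp add: w_def)
  \<comment> \<open>Expanding the inner \<open>w\<close> leaves a term \<open>w (B (t v))\<close>,
    which is \<open>t (B v)\<close> and cancels.\<close>
  have wBw: "w (B (w v)) = B v" for v
  proof -
    have "w (B (w v)) = B v + t (B v) + (B (t v) + t (B (t v)))"
      unfolding w_def B_minus B_add map_minus map_add minus_add_distrib minus_minus
      by (simp only: add_ac)
    then show ?thesis by (simp flip: wBt[of v])
  qed
  have wBw_pow: "(w ^^ n) (B ((w ^^ n) v)) = B v" for n v
  proof (induction n arbitrary: v)
    case (Suc n)
    have "(w ^^ Suc n) (B ((w ^^ Suc n) v)) = w ((w ^^ n) (B ((w ^^ n) (w v))))"
      by (simp add: funpow_swap1)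
    then show ?case by (simp only: Suc.IH wBw)
  qed simp
  have BB: "B (B v) = v" for v
  proof (rule pair.linear_eq_on[of "\<lambda>v. B (B v)" "\<lambda>v. v" v X])
    show "Vector_Spaces.linear scale scale (\<lambda>v. B (B v))" "Vector_Spaces.linear scale scale (\<lambda>v. v)"
      by (simp_all add: Vector_Spaces.linear_iff vector_space_axioms B_add B_scale)
    show "v \<in> span X" using X(2) by simp
    fix x assume "x \<in> X"
    \<comment> \<open>Both sides have the same image \<open>B x\<close> under the injective map
      \<open>w ^^ d x\<close>.\<close>
    then show "B (B x) = x" using wBw_pow[of "d x" x] B(2) inj_w_pow by metis
  qed
  \<comment> \<open>The two signs in \<open>wBw\<close> cancel, which leaves
    \<open>u B u = B\<close> for \<open>u = 1 + t\<close>.\<close>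
  have "B (v + t v) + t (B (v + t v)) = B v" for v
    using wBw[of v] unfolding w_def B_minus map_minus by (simp add: add.commute)
  with BB have "B (B (v + t v) + t (B (v + t v))) = v" for v by simp
  with B(1) BB show ?thesis by (rule that)
qed

end

section \<open>Column-finite matrices as endomorphisms of the polynomials\<close>

text \<open>Polynomials model the finitely supported sequences, with the monomials as standard
  basis.\<close>

definition matrix_of :: "('a::field poly \<Rightarrow> 'a poly) \<Rightarrow> nat \<Rightarrow> nat \<Rightarrow> 'a" where
  "matrix_of L = (\<lambda>i j. coeff (L (monom 1 j)) i)"

lemma vector_space_poly: "vector_space (smult :: 'a::field \<Rightarrow> 'a poly \<Rightarrow> 'a poly)"
  by unfold_locales (simp_all add: smult_add_right smult_add_left)

lemma poly_eq_sum_monom_1: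
  assumes "degree (p :: 'a::field poly) \<le> n"
  shows "p = (\<Sum>k\<le>n. smult (coeff p k) (monom 1 k))"
  using poly_as_sum_of_monoms'[OF assms] by (simp add: smult_monom)

lemma column_finite_matrix_of: "column_finite (matrix_of L)"
  unfolding column_finite_def matrix_of_def
  by (intro allI finite_subset[OF _ finite_atMost]) (auto intro: le_degree)

lemma matrix_of_comp:
  assumes "Vector_Spaces.linear smult smult L"
  shows "matrix_of (L \<circ> L') = cf_mult (matrix_of L) (matrix_of L')"
proof (intro ext)
  fix i j
  interpret L: Vector_Spaces.linear smult smult L by fact
  define p where "p = L' (monom 1 j)"
  have "L p = (\<Sum>k\<le>degree p. smult (coeff p k) (L (monom 1 k)))"
    by (subst poly_eq_sum_monom_1[OF order_refl]) (simp add: L.sum L.scale)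
  then have "coeff (L p) i = (\<Sum>k\<le>degree p. coeff (L (monom 1 k)) i * coeff p k)"
    by (simp add: coeff_sum mult.commute)
  also have "\<dots> = cf_mult (matrix_of L) (matrix_of L') i j"
    by (subst cf_mult_superset[of "{..degree p}"]) (auto simp: matrix_of_def p_def intro: le_degree)
  finally show "matrix_of (L \<circ> L') i j = cf_mult (matrix_of L) (matrix_of L') i j"
    by (simp add: matrix_of_def p_def)
qed

lemma matrix_of_surj:
  fixes A :: "nat \<Rightarrow> nat \<Rightarrow> 'a::field"
  assumes A: "column_finite A"
  obtains L where "Vector_Spaces.linear smult smult L" and "matrix_of L = A"
proof -
  define col where "col j = Abs_poly (\<lambda>i. A i j)" for j
  have col: "coeff (col j) = (\<lambda>i. A i j)" for j
    unfolding col_def using A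
    by (intro Abs_poly_inverse) (simp add: column_finite_def eventually_cofinite)
  define L where "L p = (\<Sum>k\<le>degree p. smult (coeff p k) (col k))" for p
  \<comment> \<open>With any bound on the degree allowed, one sum range serves \<open>p\<close>,
    \<open>q\<close> and \<open>p + q\<close>, even if the degree drops.\<close>
  have L: "L p = (\<Sum>k\<le>n. smult (coeff p k) (col k))" if "degree p \<le> n" for p n
    unfolding L_def using that by (intro sum.mono_neutral_left) (auto simp: coeff_eq_0)
  have "L (p + q) = L p + L q" for p q
  proof -
    define n where "n = max (degree p) (degree q)"
    have "degree (p + q) \<le> n" "degree p \<le> n" "degree q \<le> n"
      by (auto simp: n_def degree_add_le)
    then show ?thesis by (simp add: L[of _ n] smult_add_left sum.distrib)
  qed
  moreover have "L (smult c p) = smult c (L p)" for c p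
    by (rule poly_eqI)
      (simp add: L[of _ "degree p"] degree_smult_le coeff_sum sum_distrib_left mult.assoc)
  ultimately have "Vector_Spaces.linear smult smult L"
    by (simp add: Vector_Spaces.linear_iff vector_space_poly)
  moreover have "matrix_of L = A"
  proof (intro ext)
    fix i j
    have "L (monom 1 j) = (\<Sum>k\<le>j. if k = j then col j else 0)"
      unfolding L[OF degree_monom_le] by (intro sum.cong) auto
    then show "matrix_of L i j = A i j" by (simp add: matrix_of_def col)
  qed
  ultimately show ?thesis by (rule that)
qed

lemma involution_matrix_of:
  fixes L :: "'a::field poly \<Rightarrow> 'a poly"
  assumes L: "Vector_Spaces.linear smult smult L" and "\<And>p. L (L p) = p"
  shows "involution M_Cf (matrix_of L)" and "matrix_of L \<in> GL_Cf"
proof -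
  have "cf_mult (matrix_of L) (matrix_of L) = matrix_of (\<lambda>p. p)"
    using assms by (simp add: o_def flip: matrix_of_comp)
  moreover have "matrix_of (\<lambda>p :: 'a poly. p) = \<one>\<^bsub>M_Cf\<^esub>"
    by (auto simp: matrix_of_def M_Cf_def fun_eq_iff)
  ultimately show "involution M_Cf (matrix_of L)"
    using column_finite_matrix_of[of L] by (simp add: involution_def M_Cf_def)
  then show "matrix_of L \<in> GL_Cf"
    by (auto simp: involution_def Units_def)
qed

theorem theorem1p9:
  fixes A :: "nat \<Rightarrow> nat \<Rightarrow> 'a::field"
  assumes "A \<in> carrier M_Cf" and "strictly_upper_triangular A"
  shows "\<exists>B\<in>GL_Cf. \<exists>C\<in>GL_Cf. involution M_Cf B \<and> involution M_Cf C \<and>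
           \<one>\<^bsub>M_Cf\<^esub> \<oplus>\<^bsub>M_Cf\<^esub> A = B \<otimes>\<^bsub>M_Cf\<^esub> C"
proof -
  obtain t where t: "Vector_Spaces.linear smult smult t" and A: "matrix_of t = A"
    using matrix_of_surj[of A] assms(1) by (auto simp: M_Cf_def)
  interpret endomorphism smult t
    using t by (simp add: endomorphism_def endomorphism_axioms_def Vector_Spaces.linear_iff)
  let ?e = "monom (1 :: 'a)"
  \<comment> \<open>Column \<open>n\<close> of \<open>A\<close> is supported on the rows
    \<open>k < n\<close>.\<close>
  have "t (?e n) \<in> span (?e ` {..<n})" for n
  proof -
    let ?p = "t (?e n)"
    have "coeff ?p k = 0" if "\<not> k < n" for k
      using assms(2) that by (simp add: strictly_upper_triangular_def matrix_of_def flip: A)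
    then have "smult (coeff ?p k) (?e k) \<in> span (?e ` {..<n})" for k
      by (cases "k < n") (auto intro: span_scale span_base span_zero)
    then show ?thesis by (subst poly_eq_sum_monom_1[OF order_refl]) (rule span_sum)
  qed
  moreover have "span (range ?e) = UNIV"
  proof -
    have "p \<in> span (range ?e)" for p
      by (subst poly_eq_sum_monom_1[OF order_refl]) (intro span_sum span_scale span_base rangeI)
    then show ?thesis by auto
  qed
  ultimately obtain B where B: "Vector_Spaces.linear smult smult B" "\<And>p. B (B p) = p"
    "\<And>p. B (B (p + t p) + t (B (p + t p))) = p"
    using involution_exists[of ?e] by blast
  \<comment> \<open>The third property of \<open>B\<close> says that \<open>C\<close> is an
    involution, and \<open>B (C p) = p + t p\<close> yields the factorization.\<close>
  define C where "C p = B (p + t p)" for p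
  have C: "Vector_Spaces.linear smult smult C"
    using B(1) t by (auto simp: C_def Vector_Spaces.linear_iff smult_add_right add_ac)
  have "C (C p) = p" for p using B(3) by (simp add: C_def)
  note invs = involution_matrix_of[OF B(1,2)] involution_matrix_of[OF C this]
  have "cf_mult (matrix_of B) (matrix_of C) = matrix_of (\<lambda>p. p + t p)"
    using B(2) by (simp add: o_def C_def flip: matrix_of_comp[OF B(1)])
  also have "\<dots> = (\<lambda>i j. (if i = j then 1 else 0) + A i j)"
    by (auto simp: matrix_of_def fun_eq_iff simp flip: A)
  finally have "\<one>\<^bsub>M_Cf\<^esub> \<oplus>\<^bsub>M_Cf\<^esub> A = matrix_of B \<otimes>\<^bsub>M_Cf\<^esub> matrix_of C"
    by (simp add: M_Cf_def)
  with invs show ?thesis by blast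
qed

end
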